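(* Let $\lambda$ be a locally finite measure on $\mathbb X$ and $\eta$ a Poisson process on $\mathbb X$ with intensity measure $\lambda$. Let $Z$ be a stopping set such that $\lambda(Z(\mu))>0$ for every $\mu\in\mathbf N$. Assume that there exists a finite measurable partition $\{C_i:i=1,\dots,m\}$ of $\mathbb X$ such that, for every $i$, $\mathbb P(\lambda(C_i\cap Z(\eta))=0)>0$. Then there is no $\lambda$-continuous CTDT $\{Z_t:t\in\mathbb R_+\}$ such that $Z=\bigcup_{t}Z_t$.
   Context: $(\mathbb X,\mathcal X)$ is a Borel space (measurably isomorphic to a Borel subset of $[0,1]$). Fix an increasing sequence $B_n\in\mathcal X$ with $B_n\uparrow\mathbb X$, and let $\mathcal X_0:=\{B\cap B_n:B\in\mathcal X,n\in\mathbb N\}$. A measure on $\mathbb X$ is locally finite if it is finite on $\mathcal X_0$. $\mathbf N$ is the set of all measures on $\mathbb X$ that are $\mathbb N_0$-valued on $\mathcal X_0$, with the $\sigma$-field generated by $\mu\mapsto\mu(B)$, $B\in\mathcal X$. For a measure $\nu$ and $B\in\mathcal X$, $\nu_B:=\nu(\cdot\cap B)$. A Poisson process with intensity $\lambda$ is a random element $\eta$ of $\mathbf N$ with $\eta(B)$ Poisson of mean $\lambda(B)$ and independent values on disjoint sets. Stopping set: a map $Z:\mathbf N\to\mathcal X$ such that $(x,\mu)\mapsto\mathbf 1\{x\in Z(\mu)\}$ is measurable and $Z(\mu)=Z(\mu_{Z(\mu)}+\psi_{Z(\mu)^c})$ for all $\mu,\psi\in\mathbf N$. Continuous-time decision tree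 (CTDT): a family $\{Z_t:t\in\mathbb R_+\}$ of stopping sets with values in $\mathcal X_0$ such that $\mathbb E[\lambda(Z_0(\eta))]=0$, $Z_s\subset Z_t$ for $s\le t$, and $Z_t=\bigcap_{s>t}Z_s$ for $t\in\mathbb R_+$. Write $Z_{t-}:=\bigcup_{s<t}Z_s$ for $t>0$ and $Z_{0-}:=\emptyset$. The CTDT is $\lambda$-continuous if $\lambda(Z_t(\mu)\setminus Z_{t-}(\mu))=0$ for all $\mu\in\mathbf N$ and $t\in\mathbb R_+$. *)

theory Defs
  imports "HOL-Probability.Probability"
begin

definition borel_iso_space :: "'a measure \<Rightarrow> bool" where
  "borel_iso_space M \<longleftrightarrow>
     (\<exists>(S :: real set) f g.
        S \<in> sets borel \<and> S \<subseteq> {0..1} \<and>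
        f \<in> measurable M (restrict_space borel S) \<and>
        g \<in> measurable (restrict_space borel S) M \<and>
        (\<forall>x\<in>space M. g (f x) = x) \<and> (\<forall>y\<in>S. f (g y) = y))"

definition localizing_seq :: "'a measure \<Rightarrow> (nat \<Rightarrow> 'a set) \<Rightarrow> bool" where
  "localizing_seq M B \<longleftrightarrow> range B \<subseteq> sets M \<and> incseq B \<and> (\<Union>n. B n) = space M"

definition local_sets :: "'a measure \<Rightarrow> (nat \<Rightarrow> 'a set) \<Rightarrow> 'a set set" where
  "local_sets M B = {A \<inter> B n | A n. A \<in> sets M}"

definition locally_finite :: "'a measure \<Rightarrow> (nat \<Rightarrow> 'a set) \<Rightarrow> 'a measure \<Rightarrow> bool" where
  "locally_finite M B \<nu> \<longleftrightarrow>
     sets \<nu> = sets M \<and> (\<forall>A\<in>local_sets M B. emeasure \<nu> A < \<infinity>)"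

definition counting_measures :: "'a measure \<Rightarrow> (nat \<Rightarrow> 'a set) \<Rightarrow> 'a measure set" where
  "counting_measures M B =
     {\<mu>. sets \<mu> = sets M \<and> (\<forall>A\<in>local_sets M B. emeasure \<mu> A \<in> \<nat>)}"

text \<open>Here \<open>M\<close> only supplies the measurable space, and the result is again
  only used as a measurable space. The sigma-field is generated by the evaluation maps on
  all of \<^term>\<open>sets M\<close>, in the style of \<^const>\<open>subprob_algebra\<close>.\<close>

definition counting_space :: "'a measure \<Rightarrow> (nat \<Rightarrow> 'a set) \<Rightarrow> 'a measure measure" where
  "counting_space M B =
     (SUP A\<in>sets M. vimage_algebra (counting_measures M B) (\<lambda>\<mu>. emeasure \<mu> A) borel)"

lemma space_counting_space: "space (counting_space M B) = counting_measures M B"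
  by (auto simp: counting_space_def space_Sup_eq_UN)

lemma measurable_emeasure_counting_space:
  "A \<in> sets M \<Longrightarrow> (\<lambda>\<mu>. emeasure \<mu> A) \<in> borel_measurable (counting_space M B)"
  by (auto intro!: measurable_Sup1 measurable_vimage_algebra1 simp: counting_space_def)

definition restr_measure :: "'a measure \<Rightarrow> 'a set \<Rightarrow> 'a measure" where
  "restr_measure \<nu> A = measure_of (space \<nu>) (sets \<nu>) (\<lambda>E. emeasure \<nu> (E \<inter> A))"

definition add_measure :: "'a measure \<Rightarrow> 'a measure \<Rightarrow> 'a measure" where
  "add_measure \<mu> \<psi> =
     measure_of (space \<mu>) (sets \<mu>) (\<lambda>E. emeasure \<mu> E + emeasure \<psi> E)"

lemma sets_restr_measure: "sets (restr_measure \<nu> A) = sets \<nu>"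
  by (simp add: restr_measure_def)

lemma sets_add_measure: "sets (add_measure \<mu> \<psi>) = sets \<mu>"
  by (simp add: add_measure_def)

lemma emeasure_restr_measure:
  assumes "A \<in> sets \<nu>" "E \<in> sets \<nu>"
  shows "emeasure (restr_measure \<nu> A) E = emeasure \<nu> (E \<inter> A)"
proof -
  have "countably_additive (sets \<nu>) (\<lambda>E. emeasure \<nu> (E \<inter> A))"
  proof (rule countably_additiveI)
    fix F :: "nat \<Rightarrow> 'a set"
    assume F: "range F \<subseteq> sets \<nu>" "disjoint_family F"
    have "(\<Sum>i. emeasure \<nu> (F i \<inter> A)) = emeasure \<nu> (\<Union>i. F i \<inter> A)"
      using F assms by (intro suminf_emeasure) (auto simp: disjoint_family_on_def)
    then show "(\<Sum>i. emeasure \<nu> (F i \<inter> A)) = emeasure \<nu> ((\<Union>i. F i) \<inter> A)"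
      by simp
  qed
  then show ?thesis
    using assms
    by (intro emeasure_measure_of[OF restr_measure_def])
       (auto simp: positive_def sets_restr_measure dest: sets.sets_into_space)
qed

lemma emeasure_add_measure:
  assumes "sets \<psi> = sets \<mu>" "E \<in> sets \<mu>"
  shows "emeasure (add_measure \<mu> \<psi>) E = emeasure \<mu> E + emeasure \<psi> E"
proof -
  have "countably_additive (sets \<mu>) (\<lambda>E. emeasure \<mu> E + emeasure \<psi> E)"
  proof (rule countably_additiveI)
    fix F :: "nat \<Rightarrow> 'a set"
    assume F: "range F \<subseteq> sets \<mu>" "disjoint_family F"
    then show "(\<Sum>i. emeasure \<mu> (F i) + emeasure \<psi> (F i)) =
        emeasure \<mu> (\<Union>i. F i) + emeasure \<psi> (\<Union>i. F i)"
      using assms by (simp add: suminf_add[symmetric] suminf_emeasure)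
  qed
  then show ?thesis
    using assms
    by (intro emeasure_measure_of[OF add_measure_def])
       (auto simp: positive_def sets_add_measure dest: sets.sets_into_space)
qed

text \<open>The library's \<^const>\<open>poisson_pmf\<close> requires a positive real rate; the
  usual conventions for the means \<open>0\<close> and \<open>\<infinity>\<close> are point masses.\<close>

definition poisson_law :: "ennreal \<Rightarrow> ennreal measure" where
  "poisson_law r =
     (if r = 0 then return borel 0
      else if r = \<infinity> then return borel \<infinity>
      else distr (measure_pmf (poisson_pmf (enn2real r))) borel of_nat)"

definition poisson_process ::
  "'a measure \<Rightarrow> (nat \<Rightarrow> 'a set) \<Rightarrow> 'a measure \<Rightarrow> 'w measure \<Rightarrow> ('w \<Rightarrow> 'a measure) \<Rightarrow> bool" where
  "poisson_process M B L P \<eta> \<longleftrightarrow>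
     \<eta> \<in> measurable P (counting_space M B) \<and>
     (\<forall>A\<in>sets M. distr P borel (\<lambda>\<omega>. emeasure (\<eta> \<omega>) A) = poisson_law (emeasure L A)) \<and>
     (\<forall>(k::nat) A. (\<forall>i<k. A i \<in> sets M) \<longrightarrow> disjoint_family_on A {..<k} \<longrightarrow>
        prob_space.indep_vars P (\<lambda>_. borel) (\<lambda>i \<omega>. emeasure (\<eta> \<omega>) (A i)) {..<k})"

definition stopping_set ::
  "'a measure \<Rightarrow> (nat \<Rightarrow> 'a set) \<Rightarrow> ('a measure \<Rightarrow> 'a set) \<Rightarrow> bool" where
  "stopping_set M B Z \<longleftrightarrow>
     (\<forall>\<mu>\<in>counting_measures M B. Z \<mu> \<in> sets M) \<and>
     Measurable.pred (M \<Otimes>\<^sub>M counting_space M B) (\<lambda>(x, \<mu>). x \<in> Z \<mu>) \<and>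
     (\<forall>\<mu>\<in>counting_measures M B. \<forall>\<psi>\<in>counting_measures M B.
        Z \<mu> = Z (add_measure (restr_measure \<mu> (Z \<mu>)) (restr_measure \<psi> (space M - Z \<mu>))))"

text \<open>The time index set is \<open>{0..}\<close>; values of \<open>Z\<close> at negative times are irrelevant.\<close>

definition ctdt ::
  "'a measure \<Rightarrow> (nat \<Rightarrow> 'a set) \<Rightarrow> 'a measure \<Rightarrow> 'w measure \<Rightarrow> ('w \<Rightarrow> 'a measure) \<Rightarrow>
   (real \<Rightarrow> 'a measure \<Rightarrow> 'a set) \<Rightarrow> bool" where
  "ctdt M B L P \<eta> Z \<longleftrightarrow>
     (\<forall>t\<ge>0. stopping_set M B (Z t)) \<and>
     (\<forall>t\<ge>0. \<forall>\<mu>\<in>counting_measures M B. Z t \<mu> \<in> local_sets M B) \<and>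
     (\<integral>\<^sup>+ \<omega>. emeasure L (Z 0 (\<eta> \<omega>)) \<partial>P) = 0 \<and>
     (\<forall>s t. 0 \<le> s \<longrightarrow> s \<le> t \<longrightarrow> (\<forall>\<mu>\<in>counting_measures M B. Z s \<mu> \<subseteq> Z t \<mu>)) \<and>
     (\<forall>t\<ge>0. \<forall>\<mu>\<in>counting_measures M B. Z t \<mu> = (\<Inter>s\<in>{t<..}. Z s \<mu>))"

definition left_limit ::
  "(real \<Rightarrow> 'a measure \<Rightarrow> 'a set) \<Rightarrow> real \<Rightarrow> 'a measure \<Rightarrow> 'a set" where
  "left_limit Z t \<mu> = (\<Union>s\<in>{0..<t}. Z s \<mu>)"

definition continuous_ctdt ::
  "'a measure \<Rightarrow> (nat \<Rightarrow> 'a set) \<Rightarrow> 'a measure \<Rightarrow> (real \<Rightarrow> 'a measure \<Rightarrow> 'a set) \<Rightarrow> bool" where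
  "continuous_ctdt M B L Z \<longleftrightarrow>
     (\<forall>\<mu>\<in>counting_measures M B. \<forall>t\<ge>0. emeasure L (Z t \<mu> - left_limit Z t \<mu>) = 0)"

end

theory Submission
  imports Defs
begin

text \<open>Until the exploration \<open>Z\<^sub>t(\<eta>)\<close> meets a point of \<open>\<eta>\<close>, it coincides with the
  deterministic exploration \<open>Z\<^sub>t(0)\<close>. Let \<open>t\<^sub>0\<close> be the time at which \<open>Z\<^sub>t(0)\<close> starts to charge
  \<open>\<lambda>\<close>. Some cell \<open>C\<^sub>i\<close> is charged by \<open>Z\<^sub>s(0)\<close> for all \<open>s > t\<^sub>0\<close>, so if \<open>Z(\<eta>)\<close> does not charge
  \<open>C\<^sub>i\<close>, then \<open>\<eta>\<close> has a point in every \<open>Z\<^sub>s(0)\<close>, \<open>s > t\<^sub>0\<close>. By continuity \<open>\<lambda>(Z\<^sub>s(0))\<close> decreases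
  to \<open>0\<close> as \<open>s\<close> decreases to \<open>t\<^sub>0\<close>, hence the latter event has probability zero.\<close>

lemma null_measure_counting: "null_measure M \<in> counting_measures M B"
  by (simp add: counting_measures_def)

text \<open>If \<open>\<mu>\<close> does not charge the set explored from the empty configuration,
  then \<open>\<mu>\<close> equals its own restriction to the complement of that set. Perturbing the
  empty configuration by \<open>\<mu>\<close> off the explored set therefore produces exactly
  \<open>\<mu>\<close>, and the stopping property forbids this perturbation to change
  \<open>Z\<close>.\<close>

lemma stopping_set_eq_null:
  assumes Z: "stopping_set M B Z" and \<mu>: "\<mu> \<in> counting_measures M B"
    and zero: "emeasure \<mu> (Z (null_measure M)) = 0"
  shows "Z \<mu> = Z (null_measure M)"
proof -
  let ?A = "Z (null_measure M)"
  let ?\<nu> = "add_measure (restr_measure (null_measure M) ?A) (restr_measure \<mu> (space M - ?A))"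
  have A: "?A \<in> sets M"
    using Z null_measure_counting by (auto simp: stopping_set_def)
  have s: "sets \<mu> = sets M"
    using \<mu> by (simp add: counting_measures_def)
  have "?\<nu> = \<mu>"
  proof (rule measure_eqI)
    fix E assume "E \<in> sets ?\<nu>"
    then have E: "E \<in> sets M" by (simp add: sets_add_measure sets_restr_measure)
    have "emeasure ?\<nu> E = emeasure \<mu> (E \<inter> (space M - ?A))"
      using E A s by (simp add: emeasure_add_measure emeasure_restr_measure sets_restr_measure)
    also have "E \<inter> (space M - ?A) = E - ?A"
      using sets.sets_into_space[OF E] by auto
    also have "emeasure \<mu> (E - ?A) = emeasure \<mu> E"
      using A E s zero by (intro emeasure_Diff_null_set null_setsI) auto
    finally show "emeasure ?\<nu> E = emeasure \<mu> E" .
  qed (simp add: sets_add_measure sets_restr_measure s)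
  moreover have "Z (null_measure M) = Z ?\<nu>"
    using Z \<mu> null_measure_counting[of M B] unfolding stopping_set_def by metis
  ultimately show ?thesis by simp
qed

text \<open>For positive mean the left side is 1 - exp(-r), and 1 - r <= exp(-r). For mean zero the
  law is the point mass at 0.\<close>

lemma poisson_law_nonzero_le:
  assumes "r < \<infinity>"
  shows "emeasure (poisson_law r) (- {0}) \<le> r"
proof (cases "r = 0")
  case True
  then show ?thesis by (simp add: poisson_law_def)
next
  case False
  define q where "q = enn2real r"
  have q: "q > 0" "r = ennreal q"
    using False assms by (auto simp: q_def enn2real_positive_iff less_top zero_less_iff_neq_zero)
  have "emeasure (poisson_law r) (- {0}) = emeasure (measure_pmf (poisson_pmf q)) (- {0})"
    using False assms
    by (auto simp: poisson_law_def q_def emeasure_distr intro!: arg_cong2[where f = emeasure])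
  also have "\<dots> = ennreal (1 - pmf (poisson_pmf q) 0)"
    by (simp add: measure_pmf.emeasure_eq_measure measure_pmf.prob_compl[of "{0}", simplified]
        Compl_eq_Diff_UNIV pmf.rep_eq)
  also have "\<dots> \<le> r"
    using q exp_ge_add_one_self[of "-q"] by (simp add: ennreal_leI)
  finally show ?thesis .
qed

text \<open>Only the marginal law of the count in \<open>A\<close> enters. Measurability of the
  hitting event is recorded separately because a smaller event is later compared with it.\<close>

lemma poisson_process_hit_le:
  assumes \<eta>: "poisson_process M B L P \<eta>" and A: "A \<in> sets M" and fin: "emeasure L A < \<infinity>"
  shows "{\<omega> \<in> space P. emeasure (\<eta> \<omega>) A \<noteq> 0} \<in> sets P"
    and "emeasure P {\<omega> \<in> space P. emeasure (\<eta> \<omega>) A \<noteq> 0} \<le> emeasure L A"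
proof -
  have "\<eta> \<in> measurable P (counting_space M B)"
    using \<eta> by (simp add: poisson_process_def)
  from measurable_compose[OF this measurable_emeasure_counting_space[OF A]]
  have m [measurable]: "(\<lambda>\<omega>. emeasure (\<eta> \<omega>) A) \<in> borel_measurable P" .
  show "{\<omega> \<in> space P. emeasure (\<eta> \<omega>) A \<noteq> 0} \<in> sets P" by measurable
  have "emeasure P {\<omega> \<in> space P. emeasure (\<eta> \<omega>) A \<noteq> 0} =
      emeasure (distr P borel (\<lambda>\<omega>. emeasure (\<eta> \<omega>) A)) (- {0})"
    by (subst emeasure_distr) (auto intro!: arg_cong2[where f = emeasure])
  also have "\<dots> \<le> emeasure L A"
    using \<eta> A fin poisson_law_nonzero_le by (simp add: poisson_process_def)
  finally show "emeasure P {\<omega> \<in> space P. emeasure (\<eta> \<omega>) A \<noteq> 0} \<le> emeasure L A" .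
qed

text \<open>This is the deterministic half of the argument, with \<open>t0\<close> the infimum of
  the times of positive mass. The sets before \<open>t0\<close> are null, so the condition
  \<open>left\<close> makes \<open>A t0\<close> null as well; \<open>right\<close> and finiteness
  then carry this over to the limit from the right.\<close>

lemma onset_of_increasing_family:
  fixes A :: "real \<Rightarrow> 'a set"
  assumes sets: "\<And>t. t \<ge> 0 \<Longrightarrow> A t \<in> sets L"
    and fin: "\<And>t. t \<ge> 0 \<Longrightarrow> emeasure L (A t) < \<infinity>"
    and mono: "\<And>s t. 0 \<le> s \<Longrightarrow> s \<le> t \<Longrightarrow> A s \<subseteq> A t"
    and right: "\<And>t. t \<ge> 0 \<Longrightarrow> A t = (\<Inter>s\<in>{t<..}. A s)"
    and left: "\<And>t. t \<ge> 0 \<Longrightarrow> emeasure L (A t - (\<Union>s\<in>{0..<t}. A s)) = 0"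
    and pos: "emeasure L (\<Union>t\<in>{0..}. A t) > 0"
  obtains t0 where "t0 \<ge> 0" "\<And>s. s > t0 \<Longrightarrow> emeasure L (A s) > 0"
    "(\<lambda>n. emeasure L (A (t0 + inverse (real (Suc n))))) \<longlonglongrightarrow> 0"
proof -
  define S where "S = {t. t \<ge> 0 \<and> emeasure L (A t) > 0}"
  define t0 where "t0 = Inf S"
  have "S \<noteq> {}"
  proof
    assume "S = {}"
    then have "A t \<in> null_sets L" if "t \<ge> 0" for t
      using that sets by (auto simp: S_def null_sets_def zero_less_iff_neq_zero)
    then have "(\<Union>n. A (real n)) \<in> null_sets L" by (intro null_sets_UN) auto
    \<comment> \<open>Monotonicity replaces the uncountable union by a countable one, to which
      countable subadditivity applies.\<close>
    moreover have "(\<Union>t\<in>{0..}. A t) = (\<Union>n. A (real n))"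
      using mono real_arch_simple by fastforce
    ultimately show False using pos by auto
  qed
  have bdd: "bdd_below S" by (intro bdd_belowI[of _ 0]) (auto simp: S_def)
  have t0: "t0 \<ge> 0" unfolding t0_def using \<open>S \<noteq> {}\<close> by (intro cInf_greatest) (auto simp: S_def)
  have after: "emeasure L (A s) > 0" if s: "s > t0" for s
  proof -
    obtain u where u: "u \<in> S" "u < s"
      using s cInf_less_iff[OF \<open>S \<noteq> {}\<close> bdd] by (auto simp: t0_def)
    then have "emeasure L (A u) \<le> emeasure L (A s)"
      using mono sets by (intro emeasure_mono) (auto simp: S_def)
    then show ?thesis using u by (auto simp: S_def)
  qed
  have before: "A s \<in> null_sets L" if "0 \<le> s" "s < t0" for s
    using that sets cInf_lower[OF _ bdd, of s]
    by (auto simp: S_def t0_def null_sets_def zero_less_iff_neq_zero not_le[symmetric])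
  \<comment> \<open>Again monotonicity reduces the union to a countable one, now over the rational
    times before \<open>t0\<close>.\<close>
  have "(\<Union>s\<in>{0..<t0}. A s) = (\<Union>s\<in>{0..<t0} \<inter> \<rat>. A s)"
  proof -
    have "\<exists>q\<in>{0..<t0} \<inter> \<rat>. x \<in> A q" if "0 \<le> s" "s < t0" "x \<in> A s" for s x
    proof -
      obtain q where "q \<in> \<rat>" "s < q" "q < t0" using Rats_dense_in_real \<open>s < t0\<close> by blast
      then show ?thesis using that mono[of s q] by (intro bexI[of _ q]) auto
    qed
    then show ?thesis by auto
  qed
  then have "(\<Union>s\<in>{0..<t0}. A s) \<in> null_sets L"
    using before countable_rat by (auto intro!: null_sets_UN')
  \<comment> \<open>For \<open>t0 = 0\<close> the union is empty and \<open>left\<close> itself says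
    that \<open>A 0\<close> is null.\<close>
  then have "emeasure L (A t0) = 0"
    using left[OF t0] sets[OF t0] by (simp add: emeasure_Diff_null_set)
  moreover have "(\<Inter>n. A (t0 + inverse (real (Suc n)))) = A t0"
  proof -
    have "x \<in> A s" if x: "\<And>n. x \<in> A (t0 + inverse (real (Suc n)))" and "s > t0" for x s
    proof -
      obtain n where "inverse (real (Suc n)) < s - t0"
        using reals_Archimedean[of "s - t0"] \<open>s > t0\<close> by auto
      then show ?thesis using x[of n] mono[of "t0 + inverse (real (Suc n))" s] t0 by auto
    qed
    then show ?thesis by (subst right[OF t0]) auto
  qed
  moreover have "(\<lambda>n. emeasure L (A (t0 + inverse (real (Suc n))))) \<longlonglongrightarrow>
      emeasure L (\<Inter>n. A (t0 + inverse (real (Suc n))))"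
  proof (intro Lim_emeasure_decseq)
    show "range (\<lambda>n. A (t0 + inverse (real (Suc n)))) \<subseteq> sets L" using sets t0 by auto
    show "decseq (\<lambda>n. A (t0 + inverse (real (Suc n))))"
      using t0 by (intro decseq_SucI mono) (auto simp: field_simps)
    show "emeasure L (A (t0 + inverse (real (Suc n)))) \<noteq> \<infinity>" for n
      using fin[of "t0 + inverse (real (Suc n))"] t0 by auto
  qed
  ultimately show thesis using that t0 after by simp
qed

theorem propositionB1:
  fixes M :: "'a measure" and B :: "nat \<Rightarrow> 'a set" and L :: "'a measure"
    and P :: "'w measure" and \<eta> :: "'w \<Rightarrow> 'a measure"
    and Z :: "'a measure \<Rightarrow> 'a set" and C :: "nat \<Rightarrow> 'a set" and m :: nat
  assumes "borel_iso_space M"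
    and "localizing_seq M B"
    and "locally_finite M B L"
    and "prob_space P"
    and "poisson_process M B L P \<eta>"
    and "stopping_set M B Z"
    and "\<And>\<mu>. \<mu> \<in> counting_measures M B \<Longrightarrow> emeasure L (Z \<mu>) > 0"
    and "\<And>i. i \<in> {1..m} \<Longrightarrow> C i \<in> sets M"
    and "disjoint_family_on C {1..m}"
    and "(\<Union>i\<in>{1..m}. C i) = space M"
    and "\<And>i. i \<in> {1..m} \<Longrightarrow>
           measure P {\<omega> \<in> space P. emeasure L (C i \<inter> Z (\<eta> \<omega>)) = 0} > 0"
  shows "\<not> (\<exists>Zt :: real \<Rightarrow> 'a measure \<Rightarrow> 'a set.
           ctdt M B L P \<eta> Zt \<and> continuous_ctdt M B L Zt \<and>
           (\<forall>\<mu>\<in>counting_measures M B. Z \<mu> = (\<Union>t\<in>{0..}. Zt t \<mu>)))"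
proof
  assume "\<exists>Zt :: real \<Rightarrow> 'a measure \<Rightarrow> 'a set.
           ctdt M B L P \<eta> Zt \<and> continuous_ctdt M B L Zt \<and>
           (\<forall>\<mu>\<in>counting_measures M B. Z \<mu> = (\<Union>t\<in>{0..}. Zt t \<mu>))"
  then obtain Zt where Zt: "ctdt M B L P \<eta> Zt" and cont: "continuous_ctdt M B L Zt"
    and Z: "\<And>\<mu>. \<mu> \<in> counting_measures M B \<Longrightarrow> Z \<mu> = (\<Union>t\<in>{0..}. Zt t \<mu>)"
    by blast
  interpret prob_space P by fact
  \<comment> \<open>The exploration run on the empty configuration is the deterministic reference
    family.\<close>
  define A where "A t = Zt t (null_measure M)" for t
  have stop: "\<And>t. t \<ge> 0 \<Longrightarrow> stopping_set M B (Zt t)"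
    and local: "\<forall>t\<ge>0. \<forall>\<mu>\<in>counting_measures M B. Zt t \<mu> \<in> local_sets M B"
    and mono: "\<forall>s t. 0 \<le> s \<longrightarrow> s \<le> t \<longrightarrow> (\<forall>\<mu>\<in>counting_measures M B. Zt s \<mu> \<subseteq> Zt t \<mu>)"
    and right: "\<forall>t\<ge>0. \<forall>\<mu>\<in>counting_measures M B. Zt t \<mu> = (\<Inter>s\<in>{t<..}. Zt s \<mu>)"
    using Zt unfolding ctdt_def by (elim conjE, (simp only: | assumption))+
  have L: "sets L = sets M" and locfin: "\<And>A. A \<in> local_sets M B \<Longrightarrow> emeasure L A < \<infinity>"
    using assms(3) by (auto simp: locally_finite_def)
  have A_sets: "A t \<in> sets M" if "t \<ge> 0" for t
    using stop[OF that] null_measure_counting by (auto simp: stopping_set_def A_def)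
  have A_fin: "emeasure L (A t) < \<infinity>" if "t \<ge> 0" for t
    unfolding A_def using local that null_measure_counting by (intro locfin) blast
  have A_mono: "A s \<subseteq> A t" if "0 \<le> s" "s \<le> t" for s t
    unfolding A_def using mono that null_measure_counting by blast
  obtain t0 where t0: "t0 \<ge> 0" and pos: "\<And>s. s > t0 \<Longrightarrow> emeasure L (A s) > 0"
    and lim: "(\<lambda>n. emeasure L (A (t0 + inverse (real (Suc n))))) \<longlonglongrightarrow> 0"
  proof (rule onset_of_increasing_family[of A L])
    show "A t = (\<Inter>s\<in>{t<..}. A s)" if "t \<ge> 0" for t
      unfolding A_def using right that null_measure_counting by blast
    show "emeasure L (A t - (\<Union>s\<in>{0..<t}. A s)) = 0" if "t \<ge> 0" for t
      using cont that null_measure_counting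
      by (auto simp: continuous_ctdt_def left_limit_def A_def)
    show "emeasure L (\<Union>t\<in>{0..}. A t) > 0"
      using assms(7)[OF null_measure_counting] Z[OF null_measure_counting] by (simp add: A_def)
  qed (use A_sets A_fin A_mono L in auto)
  \<comment> \<open>The cell has to be chosen before \<open>s\<close>, since one fixed event
    \<open>E\<close> is compared below with all \<open>s > t0\<close>. The finiteness of the
    partition makes this possible: otherwise each cell would be uncharged shortly after
    \<open>t0\<close>, and finitely many such conditions hold at a common \<open>s\<close>, where
    \<open>A s\<close> would be null.\<close>
  have "\<exists>i\<in>{1..m}. \<forall>s>t0. emeasure L (C i \<inter> A s) \<noteq> 0"
  proof (rule ccontr)
    assume "\<not> ?thesis"
    then have *: "\<exists>s>t0. emeasure L (C i \<inter> A s) = 0" if "i \<in> {1..m}" for i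
      using that by blast
    have "\<forall>i\<in>{1..m}. eventually (\<lambda>s. emeasure L (C i \<inter> A s) = 0) (at_right t0)"
    proof
      fix i assume i: "i \<in> {1..m}"
      from *[OF i] obtain s where s: "s > t0" "emeasure L (C i \<inter> A s) = 0" by blast
      have "emeasure L (C i \<inter> A u) = 0" if "t0 < u" "u < s" for u
      proof -
        have "emeasure L (C i \<inter> A u) \<le> emeasure L (C i \<inter> A s)"
          using that t0 L A_mono[of u s] A_sets[of s] assms(8)[OF i]
          by (intro emeasure_mono) auto
        then show ?thesis using s by simp
      qed
      then show "eventually (\<lambda>s. emeasure L (C i \<inter> A s) = 0) (at_right t0)"
        using s(1) by (auto simp: eventually_at_right)
    qed
    then have "eventually (\<lambda>s. \<forall>i\<in>{1..m}. emeasure L (C i \<inter> A s) = 0) (at_right t0)"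
      by (intro eventually_ball_finite) auto
    then have "eventually (\<lambda>s. s > t0 \<and> (\<forall>i\<in>{1..m}. emeasure L (C i \<inter> A s) = 0)) (at_right t0)"
      using eventually_at_right_less by (rule eventually_elim2) auto
    then obtain s where s: "s > t0" "\<forall>i\<in>{1..m}. emeasure L (C i \<inter> A s) = 0"
      using eventually_happens[of _ "at_right t0"] by auto
    have "(\<Union>i\<in>{1..m}. C i \<inter> A s) \<in> null_sets L"
      using s t0 L A_sets[of s] assms(8) by (intro null_sets_UN') auto
    moreover have "(\<Union>i\<in>{1..m}. C i \<inter> A s) = A s"
      using assms(10) sets.sets_into_space[OF A_sets[of s]] s t0 by fastforce
    ultimately show False using pos[OF s(1)] by auto
  qed
  then obtain i where i: "i \<in> {1..m}" and charged: "\<And>s. s > t0 \<Longrightarrow> emeasure L (C i \<inter> A s) \<noteq> 0"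
    by blast
  define E where "E = {\<omega> \<in> space P. emeasure L (C i \<inter> Z (\<eta> \<omega>)) = 0}"
  have le: "emeasure P E \<le> emeasure L (A s)" if s: "s > t0" for s
  proof -
    have s0: "s \<ge> 0" using s t0 by simp
    \<comment> \<open>If \<open>\<eta> \<omega>\<close> had no point in \<open>A s\<close>, its own
      exploration up to time \<open>s\<close> would be \<open>A s\<close>, so
      \<open>Z (\<eta> \<omega>)\<close> would contain \<open>A s\<close> and charge
      \<open>C i\<close>.\<close>
    have "E \<subseteq> {\<omega> \<in> space P. emeasure (\<eta> \<omega>) (A s) \<noteq> 0}"
    proof safe
      fix \<omega> assume "\<omega> \<in> E"
      then show \<omega>: "\<omega> \<in> space P" by (simp add: E_def)
      have "\<eta> \<in> measurable P (counting_space M B)"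
        using assms(5) by (simp add: poisson_process_def)
      from measurable_space[OF this \<omega>] have \<eta>: "\<eta> \<omega> \<in> counting_measures M B"
        by (simp add: space_counting_space)
      assume "emeasure (\<eta> \<omega>) (A s) = 0"
      then have "A s = Zt s (\<eta> \<omega>)"
        using stopping_set_eq_null[OF stop[OF s0] \<eta>] by (simp add: A_def)
      then have "A s \<subseteq> Z (\<eta> \<omega>)" using Z[OF \<eta>] s0 by auto
      moreover have "Z (\<eta> \<omega>) \<in> sets M" using assms(6) \<eta> by (simp add: stopping_set_def)
      ultimately have "emeasure L (C i \<inter> A s) \<le> emeasure L (C i \<inter> Z (\<eta> \<omega>))"
        using assms(8)[OF i] L by (intro emeasure_mono) auto
      then show False using \<open>\<omega> \<in> E\<close> charged[OF s] by (simp add: E_def)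
    qed
    then have "emeasure P E \<le> emeasure P {\<omega> \<in> space P. emeasure (\<eta> \<omega>) (A s) \<noteq> 0}"
      by (intro emeasure_mono poisson_process_hit_le(1)[OF assms(5) A_sets A_fin] s0)
    also have "\<dots> \<le> emeasure L (A s)"
      by (intro poisson_process_hit_le(2)[OF assms(5) A_sets A_fin] s0)
    finally show ?thesis .
  qed
  \<comment> \<open>The bound \<open>le\<close> is applied along the times
    \<open>t0 + 1/(n+1)\<close>, where its right side tends to 0.\<close>
  have "emeasure P E \<le> 0"
    using lim by (rule LIMSEQ_le_const) (auto intro!: le)
  then show False
    using assms(11)[OF i] by (simp add: E_def measure_def)
qed

end
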